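(* For any rational number $t > 1$, there exists no minimally $t$-tough, chordal graph with a universal vertex.
   Context: All graphs are finite, simple and undirected. $\omega(H)$ denotes the number of connected components of a graph $H$. For a real number $t$, a graph $G$ is $t$-tough if $|S| \ge t\cdot\omega(G-S)$ for every $S \subseteq V(G)$ with $\omega(G-S) > 1$. The toughness $\tau(G)$ is the largest $t$ for which $G$ is $t$-tough, where $\tau(K_n)=\infty$ for all $n\ge 1$. A graph $G$ is minimally $t$-tough if $\tau(G)=t$ and $\tau(G-e)<t$ for every $e\in E(G)$. A graph is chordal if it contains no induced cycle of length at least $4$. A universal vertex is a vertex adjacent to all the other vertices. *)

theory Defs
  imports "Graph_Theory.Graph_Theory" "HOL-Library.Extended_Real"
begin

text \<open>
  A finite simple undirected graph is a \<^locale>\<open>pair_graph\<close>: finitely many vertices, and a symmetric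
  and loop-free arc relation. An undirected edge \<open>uv\<close> is the pair of arcs \<open>(u,v)\<close> and \<open>(v,u)\<close>.
\<close>

text \<open>In a symmetric digraph the strongly connected components are the connected components.\<close>

definition num_components :: "('a, 'b) pre_digraph \<Rightarrow> nat" where
  "num_components H = card (pre_digraph.sccs H)"

definition tough :: "real \<Rightarrow> 'a pair_pre_digraph \<Rightarrow> bool" where
  "tough t G \<longleftrightarrow>
     (\<forall>S \<subseteq> pverts G. num_components (with_proj G \<restriction> (pverts G - S)) > 1 \<longrightarrow>
        real (card S) \<ge> t * real (num_components (with_proj G \<restriction> (pverts G - S))))"

text \<open>
  For a graph that is not complete the maximum exists, see \<open>tough_iff_le_toughness\<close> below. The graph
  without vertices counts as complete here.
\<close>

definition toughness :: "'a pair_pre_digraph \<Rightarrow> ereal" where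
  "toughness G = (if \<exists>n. complete_digraph n (with_proj G) then \<infinity>
                  else ereal (GREATEST t. tough t G))"

definition delete_edge :: "'a pair_pre_digraph \<Rightarrow> 'a \<Rightarrow> 'a \<Rightarrow> 'a pair_pre_digraph" where
  "delete_edge G u v = \<lparr>pverts = pverts G, parcs = parcs G - {(u, v), (v, u)}\<rparr>"

definition minimally_tough :: "real \<Rightarrow> 'a pair_pre_digraph \<Rightarrow> bool" where
  "minimally_tough t G \<longleftrightarrow>
     toughness G = ereal t \<and> (\<forall>(u, v) \<in> parcs G. toughness (delete_edge G u v) < ereal t)"

text \<open>
  A \<^const>\<open>pre_digraph.cycle\<close> is a closed walk, given as its list of arcs, without repeated vertices;
  its vertices are the tails of its arcs. It is an induced cycle iff the subgraph induced by its
  vertices has no arcs other than those of the cycle and their reversals.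
\<close>

definition induced_cycle :: "'a pair_pre_digraph \<Rightarrow> ('a \<times> 'a) awalk \<Rightarrow> bool" where
  "induced_cycle G p \<longleftrightarrow>
     pre_digraph.cycle (with_proj G) p \<and>
     arcs (with_proj G \<restriction> (fst ` set p)) = set p \<union> (set p)\<inverse>"

definition chordal :: "'a pair_pre_digraph \<Rightarrow> bool" where
  "chordal G \<longleftrightarrow> \<not> (\<exists>p. induced_cycle G p \<and> length p \<ge> 4)"

definition universal_vertex :: "'a pair_pre_digraph \<Rightarrow> 'a \<Rightarrow> bool" where
  "universal_vertex G v \<longleftrightarrow> v \<in> pverts G \<and> (\<forall>u \<in> pverts G - {v}. (v, u) \<in> parcs G)"

lemma (in pair_graph) two_nonadjacent_components:
  assumes "u \<in> pverts G" "v \<in> pverts G" "u \<noteq> v" "(u, v) \<notin> parcs G"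
  shows "num_components (with_proj G \<restriction> {u, v}) = 2"
proof -
  let ?H = "with_proj G \<restriction> {u, v}"
  interpret H: wf_digraph ?H by (rule wellformed_induce_subgraph)
  have na: "(v, u) \<notin> parcs G" using assms arcs_symmetric by blast
  have no: "arcs_ends ?H = {}"
    using assms na pair_no_loops by (fastforce simp: arcs_ends_def arc_to_ends_def)
  have reach: "x \<rightarrow>\<^sup>*\<^bsub>?H\<^esub> y \<longleftrightarrow> x = y \<and> x \<in> {u, v}" for x y
  proof
    assume "x \<rightarrow>\<^sup>*\<^bsub>?H\<^esub> y"
    then show "x = y \<and> x \<in> {u, v}"
      unfolding reachable_def no by (induct rule: rtrancl_on_induct) auto
  qed auto
  have "pre_digraph.sccs_verts ?H = {{u}, {v}}"
    unfolding H.sccs_verts_conv_scc_of pre_digraph.scc_of_def reach by auto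
  then have "card (pre_digraph.sccs_verts ?H) = 2" using assms by auto
  then show ?thesis unfolding num_components_def by (simp add: H.card_sccs_verts)
qed

lemma complete_components_le_1:
  assumes "complete_digraph n (with_proj G)"
  shows "num_components (with_proj G \<restriction> (pverts G - S)) \<le> 1"
proof -
  let ?H = "with_proj G \<restriction> (pverts G - S)"
  interpret graph "with_proj G" using assms by (simp add: complete_digraph_def)
  interpret H: wf_digraph ?H by (rule wellformed_induce_subgraph)
  have ends: "parcs G = {(u,v). (u,v) \<in> pverts G \<times> pverts G \<and> u \<noteq> v}"
    using assms by (simp add: complete_digraph_pair_def)
  have "x \<rightarrow>\<^sup>*\<^bsub>?H\<^esub> y" if "x \<in> pverts G - S" "y \<in> pverts G - S" for x y
  proof (cases "x = y")
    case True then show ?thesis using that by auto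
  next
    case False
    then have "(x, y) \<in> arcs_ends ?H"
      using that by (auto simp: arcs_ends_def arc_to_ends_def ends image_iff)
    then show ?thesis by (rule H.reachable_adjI)
  qed
  then have "pre_digraph.scc_of ?H x = pverts G - S" if "x \<in> pverts G - S" for x
    using that by (auto simp: pre_digraph.scc_of_def dest: H.reachable_in_verts)
  then have "pre_digraph.sccs_verts ?H \<subseteq> {pverts G - S}"
    unfolding H.sccs_verts_conv_scc_of by auto
  then have "card (pre_digraph.sccs_verts ?H) \<le> 1"
    using card_mono[of "{pverts G - S}"] by fastforce
  then show ?thesis unfolding num_components_def by (simp add: H.card_sccs_verts)
qed

theorem (in pair_graph) tough_iff_le_toughness: "tough t G \<longleftrightarrow> ereal t \<le> toughness G"
proof (cases "\<exists>n. complete_digraph n (with_proj G)")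
  case True
  then obtain n where "complete_digraph n (with_proj G)" by blast
  then have "\<not> num_components (with_proj G \<restriction> (pverts G - S)) > 1" for S
    using complete_components_le_1[of n G S] by linarith
  then have "tough t G" unfolding tough_def by blast
  moreover have "toughness G = \<infinity>" using True unfolding toughness_def by simp
  ultimately show ?thesis by simp
next
  case False
  define \<omega> where "\<omega> S = num_components (with_proj G \<restriction> (pverts G - S))" for S
  define A where "A = {S. S \<subseteq> pverts G \<and> \<omega> S > 1}"
  define r where "r S = real (card S) / real (\<omega> S)" for S
  have "finite A" using pair_finite_verts unfolding A_def by simp
  have "parcs G \<subseteq> {(u, v). (u, v) \<in> pverts G \<times> pverts G \<and> u \<noteq> v}"
    using in_arcsD1 in_arcsD2 no_loops' by fast
  moreover have "parcs G \<noteq> {(u, v). (u, v) \<in> pverts G \<times> pverts G \<and> u \<noteq> v}"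
    using False pair_finite_verts unfolding complete_digraph_pair_def by blast
  ultimately obtain u v where
    uv: "u \<in> pverts G" "v \<in> pverts G" "u \<noteq> v" "(u, v) \<notin> parcs G"
    by blast
  then have "pverts G - (pverts G - {u, v}) = {u, v}" by auto
  then have "pverts G - {u, v} \<in> A"
    using two_nonadjacent_components[OF uv] by (simp add: A_def \<omega>_def)
  then have ne: "r ` A \<noteq> {}" by blast
  have "t \<le> r S \<longleftrightarrow> t * real (\<omega> S) \<le> real (card S)" if "S \<in> A" for t S
    using that by (simp add: A_def r_def pos_le_divide_eq)
  then have "tough t G \<longleftrightarrow> (\<forall>S\<in>A. t \<le> r S)" for t
    unfolding tough_def \<omega>_def[symmetric] by (auto simp: A_def)
  then have *: "tough t G \<longleftrightarrow> t \<le> Min (r ` A)" for t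
    using ne \<open>finite A\<close> by simp
  then have "(GREATEST t. tough t G) = Min (r ` A)"
    by (intro Greatest_equality) auto
  then have "toughness G = ereal (Min (r ` A))" using False unfolding toughness_def by simp
  then show ?thesis using * by simp
qed

end

theory Submission
  imports Defs
begin

text \<open>
  Let \<open>v\<close> be universal. Deleting an edge \<open>vu\<close> lowers the toughness, so some \<open>S\<close> with \<open>|S| < 2t\<close> makes
  \<open>vu\<close> a bridge of \<open>G - S\<close>; as \<open>v\<close> is universal, \<open>u\<close> is a leaf there and \<open>deg u < 2t + 1\<close>. On the
  other hand every non-universal vertex has degree at least \<open>2t\<close>, its neighbourhood being a cutset.

  Since \<open>G\<close> is not complete, there is a largest connected set \<open>A\<close> whose closed neighbourhood is not
  everything. Let \<open>B \<noteq> {}\<close> be the set of vertices outside that neighbourhood. By maximality every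
  vertex of \<open>N(A)\<close> is adjacent to all of \<open>B\<close>, and by chordality \<open>N(A)\<close> is a clique. As \<open>v\<close> alone does
  not separate \<open>A\<close> from \<open>B\<close>, there is some \<open>x \<noteq> v\<close> in \<open>N(A)\<close>. For \<open>b \<in> B\<close>, the vertex \<open>x\<close> is adjacent to
  \<open>b\<close>, to all other neighbours of \<open>b\<close>, and to a vertex of \<open>A\<close>, so \<open>deg x \<ge> deg b + 1 \<ge> 2t + 1\<close>.
\<close>

section \<open>Induced paths and chordality\<close>

text \<open>The path is built backwards from \<open>y\<close>. A new vertex \<open>x\<close> already
  on the path cuts it down to the suffix from \<open>x\<close>; otherwise \<open>x\<close> is joined
  to its last neighbour on the path, so that no chord arises.\<close>

lemma rtrancl_imp_induced_vwalk:
  assumes "sym R" "irrefl R" "R \<subseteq> W \<times> W" "y \<in> W" "(x, y) \<in> R\<^sup>*"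
  shows "\<exists>vs. vs \<noteq> [] \<and> hd vs = x \<and> last vs = y \<and> set vs \<subseteq> W \<and> distinct vs \<and>
    set (vwalk_arcs vs) \<subseteq> R \<and>
    R \<inter> set vs \<times> set vs \<subseteq> set (vwalk_arcs vs) \<union> (set (vwalk_arcs vs))\<inverse>"
  using assms(5)
proof (induction rule: converse_rtrancl_induct)
  case base
  show ?case using assms(2,4) by (intro exI[of _ "[y]"]) (auto simp: irrefl_def)
next
  case (step x x')
  then obtain vs where vs: "vs \<noteq> []" "hd vs = x'" "last vs = y" "set vs \<subseteq> W" "distinct vs"
    "set (vwalk_arcs vs) \<subseteq> R"
    "R \<inter> set vs \<times> set vs \<subseteq> set (vwalk_arcs vs) \<union> (set (vwalk_arcs vs))\<inverse>"
    by blast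
  \<comment> \<open>Every arc of \<open>vs\<close> that is not one of \<open>ws\<close> has its tail
    in \<open>us\<close>, which is disjoint from \<open>ws\<close>.\<close>
  have suffix: "R \<inter> set ws \<times> set ws \<subseteq> set (vwalk_arcs ws) \<union> (set (vwalk_arcs ws))\<inverse>"
    if "vs = us @ ws" for us ws
  proof (cases "us = [] \<or> ws = []")
    case False
    then have "vwalk_arcs vs = vwalk_arcs us @ (last us, hd ws) # vwalk_arcs ws"
      using that vwalk_arcs_append by blast
    moreover have "set us \<inter> set ws = {}" "last us \<in> set us" using False that vs(5) by auto
    ultimately show ?thesis using vs(7) that by (fastforce elim: in_set_vwalk_arcsE)
  qed (use that vs(7) in auto)
  have x: "x \<in> W" using step.hyps assms(3) by auto
  show ?case
  proof (cases "x \<in> set vs")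
    case True
    then obtain us ws where ws: "vs = us @ x # ws" by (meson split_list)
    then have "set (vwalk_arcs (x # ws)) \<subseteq> R" using vs(6) set_vwalk_arcs_append2 by blast
    then show ?thesis using ws vs suffix[OF ws] by (intro exI[of _ "x # ws"]) auto
  next
    case False
    have "\<exists>z \<in> set vs. (x, z) \<in> R" using step.hyps vs by fastforce
    \<comment> \<open>shortcut to the last neighbour of \<open>x\<close> on the path\<close>
    then obtain us z ws where ws: "vs = us @ z # ws" "(x, z) \<in> R" "\<forall>w\<in>set ws. (x, w) \<notin> R"
      using split_list_last_prop[of vs "\<lambda>z. (x, z) \<in> R"] by blast
    have "set (vwalk_arcs (z # ws)) \<subseteq> R" using ws(1) vs(6) set_vwalk_arcs_append2 by blast
    moreover have "(w, x) \<notin> R" if "w \<in> set ws" for w using that ws(3) assms(1) by (meson symD)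
    moreover have "(x, x) \<notin> R" using assms(2) by (simp add: irrefl_def)
    ultimately show ?thesis
      using ws vs(3-5) x False suffix[OF ws(1)] by (intro exI[of _ "x # z # ws"]) auto
  qed
qed

context pair_graph
begin

text \<open>Paths are built as vertex lists, whereas \<open>cycle\<close> speaks of arc
  lists.\<close>

lemma awalk_vwalk_arcs:
  assumes "vs \<noteq> []" "set vs \<subseteq> pverts G" "set (vwalk_arcs vs) \<subseteq> parcs G"
  shows "awalk (hd vs) (vwalk_arcs vs) (last vs) \<and> pawalk_verts (hd vs) (vwalk_arcs vs) = vs"
  using assms
  by (induction vs rule: vwalk_arcs.induct) (auto simp: awalk_Nil_iff awalk_Cons_iff)

text \<open>Otherwise an induced path from \<open>x\<close> to \<open>y\<close> through
  \<open>A\<close> closes up at \<open>b\<close> to an induced cycle: \<open>b\<close> has no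
  neighbour in \<open>A\<close>, hence no chord starts at \<open>b\<close>.\<close>

lemma chordal_common_neighbours_adjacent:
  assumes "chordal G"
    and conn: "\<And>a a'. a \<in> A \<Longrightarrow> a' \<in> A \<Longrightarrow> (a, a') \<in> (parcs G \<inter> A \<times> A)\<^sup>*"
    and x: "a \<in> A" "(a, x) \<in> parcs G"
    and y: "a' \<in> A" "(a', y) \<in> parcs G"
    and "x \<noteq> y"
    and b: "(b, x) \<in> parcs G" "(b, y) \<in> parcs G" "b \<notin> A" "\<And>a. a \<in> A \<Longrightarrow> (b, a) \<notin> parcs G"
  shows "(x, y) \<in> parcs G"
proof (rule ccontr)
  assume na: "(x, y) \<notin> parcs G"
  define W where "W = A \<union> {x, y}"
  define R where "R = parcs G \<inter> W \<times> W"
  have "(a, a') \<in> R\<^sup>*"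
    using conn[OF x(1) y(1)] rtrancl_mono[of "parcs G \<inter> A \<times> A" R] by (auto simp: R_def W_def)
  moreover have "(x, a) \<in> R" "(a', y) \<in> R"
    using x y arcs_symmetric by (auto simp: R_def W_def)
  ultimately have "(x, y) \<in> R\<^sup>*" by (meson converse_rtrancl_into_rtrancl rtrancl.rtrancl_into_rtrancl)
  moreover have "sym R" "irrefl R"
    using arcs_symmetric no_loops' by (auto simp: R_def sym_def irrefl_def)
  ultimately obtain vs where vs: "vs \<noteq> []" "hd vs = x" "last vs = y" "set vs \<subseteq> W" "distinct vs"
    "set (vwalk_arcs vs) \<subseteq> R"
    "R \<inter> set vs \<times> set vs \<subseteq> set (vwalk_arcs vs) \<union> (set (vwalk_arcs vs))\<inverse>"
    using rtrancl_imp_induced_vwalk[of R W y x] by (auto simp: R_def W_def)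
  \<comment> \<open>The distinct ends \<open>x\<close> and \<open>y\<close> are not adjacent, so the
    path has an inner vertex and the cycle through \<open>b\<close> has length at least 4.\<close>
  have len_vs: "length vs \<ge> 3"
  proof (cases vs rule: vwalk_arcs.cases)
    case (3 p q ws)
    then show ?thesis using vs(2,3,6) na by (cases ws) (auto simp: R_def)
  qed (use vs(1-3) \<open>x \<noteq> y\<close> in auto)
  define c where "c = b # vs @ [b]"
  have arcs_c: "vwalk_arcs c = (b, x) # vwalk_arcs (vs @ [b])" using vs unfolding c_def by simp
  have set_c: "set (vwalk_arcs c) = insert (b, x) (insert (y, b) (set (vwalk_arcs vs)))"
    unfolding arcs_c using vs by (auto simp: set_vwalk_arcs_snoc)
  have "b \<notin> W" using b no_loops' by (auto simp: W_def)
  then have bvs: "b \<notin> set vs" using vs by auto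
  have "set (vwalk_arcs c) \<subseteq> parcs G"
    unfolding set_c using b vs(6) arcs_symmetric by (auto simp: R_def)
  moreover have "set vs \<subseteq> pverts G"
  proof
    fix w assume "w \<in> set vs"
    then have "w = x \<or> w = y \<or> w \<in> A" using vs(4) by (auto simp: W_def)
    moreover have "w \<in> pverts G" if "w \<in> A"
    proof -
      have "(w, a) \<in> (parcs G \<inter> A \<times> A)\<^sup>*" using conn that x by blast
      then show ?thesis by (cases rule: converse_rtranclE) (use x in_arcsD1 in auto)
    qed
    ultimately show "w \<in> pverts G" using x y in_arcsD2 by blast
  qed
  ultimately have "awalk b (vwalk_arcs c) b \<and> pawalk_verts b (vwalk_arcs c) = c"
    using awalk_vwalk_arcs[of c] b in_arcsD1 by (auto simp: c_def)
  then have cyc: "cycle (vwalk_arcs c)"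
    unfolding cycle_def using vs(5) bvs by (intro exI[of _ b]) (auto simp: c_def arcs_c)
  have len: "length (vwalk_arcs c) = length vs + 1"
    unfolding vwalk_length_simp[unfolded vwalk_length_def] by (simp add: c_def)
  have "map fst (vwalk_arcs ws) = butlast ws" for ws :: "'a list"
    by (induction ws rule: vwalk_arcs.induct) auto
  then have fst_c: "fst ` set (vwalk_arcs c) = insert b (set vs)"
    by (metis c_def butlast.simps(2) butlast_snoc list.set_map list.simps(15) append_Cons)
  have "arcs (with_proj G \<restriction> insert b (set vs)) = set (vwalk_arcs c) \<union> (set (vwalk_arcs c))\<inverse>"
  proof -
    have star: "w = x \<or> w = y" if "w \<in> set vs" "(b, w) \<in> parcs G" for w
      using that b vs(4) by (auto simp: W_def)
    have "(p, q) \<in> set (vwalk_arcs c) \<union> (set (vwalk_arcs c))\<inverse>"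
      if pq: "(p, q) \<in> parcs G" "p \<in> insert b (set vs)" "q \<in> insert b (set vs)" for p q
    proof (cases "p = b \<or> q = b")
      case True
      then show ?thesis
        using pq star[of p] star[of q] arcs_symmetric no_loops' unfolding set_c by fastforce
    next
      case False
      then have "(p, q) \<in> R \<inter> set vs \<times> set vs" using pq vs(4) by (auto simp: R_def)
      then show ?thesis using vs(7) unfolding set_c by blast
    qed
    then have "parcs G \<inter> insert b (set vs) \<times> insert b (set vs)
        \<subseteq> set (vwalk_arcs c) \<union> (set (vwalk_arcs c))\<inverse>" by blast
    moreover have "set (vwalk_arcs c) \<subseteq> insert b (set vs) \<times> insert b (set vs)"
    proof -
      have "set c = insert b (set vs)" by (simp add: c_def)
      then show ?thesis by (auto elim: in_set_vwalk_arcsE)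
    qed
    moreover have "(set (vwalk_arcs c))\<inverse> \<subseteq> parcs G"
      using \<open>set (vwalk_arcs c) \<subseteq> parcs G\<close> arcs_symmetric by blast
    moreover have "arcs (with_proj G \<restriction> I) = parcs G \<inter> I \<times> I" for I by auto
    ultimately show ?thesis using \<open>set (vwalk_arcs c) \<subseteq> parcs G\<close> by blast
  qed
  then have "induced_cycle G (vwalk_arcs c)" unfolding induced_cycle_def fst_c using cyc by blast
  then show False using \<open>chordal G\<close> len len_vs unfolding chordal_def by force
qed

section \<open>Separators and toughness\<close>

text \<open>No arc leaves \<open>P\<close> inside \<open>T\<close>, so the component of
  \<open>p\<close> misses \<open>q\<close>.\<close>

lemma num_components_gt_1:
  assumes "T \<subseteq> pverts G" "P \<subseteq> T" "p \<in> P" "q \<in> T - P"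
    and cut: "\<And>p q. p \<in> P \<Longrightarrow> q \<in> T - P \<Longrightarrow> (p, q) \<notin> parcs G"
  shows "num_components (with_proj G \<restriction> T) > 1"
proof -
  let ?H = "with_proj G \<restriction> T"
  interpret H: wf_digraph ?H by (rule wellformed_induce_subgraph)
  have finT: "finite T" using assms(1) pair_finite_verts finite_subset by blast
  have "z \<in> P" if "p \<rightarrow>\<^sup>*\<^bsub>?H\<^esub> z" for z
    using that unfolding reachable_def
  proof (induct rule: rtrancl_on_induct)
    case (step y z)
    then have "(y, z) \<in> parcs G" "z \<in> T" by (auto simp: arcs_ends_def arc_to_ends_def)
    then show ?case using cut step by blast
  qed (use assms in auto)
  then have "q \<notin> H.scc_of p" using assms(4) by (auto simp: H.scc_of_def)
  moreover have "q \<in> H.scc_of q" using assms(4) by (auto simp: H.scc_of_def)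
  ultimately have "card {H.scc_of p, H.scc_of q} = 2" by (metis card_2_iff)
  moreover have "{H.scc_of p, H.scc_of q} \<subseteq> H.sccs_verts"
    using assms H.scc_of_in_sccs_verts by auto
  moreover have "finite H.sccs_verts"
    using finT H.sccs_verts_subsets by (auto intro!: finite_subset[of _ "Pow T"])
  ultimately have "2 \<le> card H.sccs_verts" by (metis card_mono)
  then show ?thesis by (simp add: num_components_def H.card_sccs_verts)
qed

lemma tough_imp_separator_ge:
  assumes "tough t G" "t \<ge> 0" "S \<subseteq> pverts G" "P \<subseteq> pverts G - S" "p \<in> P" "q \<in> pverts G - S - P"
    and "\<And>p q. p \<in> P \<Longrightarrow> q \<in> pverts G - S - P \<Longrightarrow> (p, q) \<notin> parcs G"
  shows "2 * t \<le> real (card S)"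
proof -
  let ?n = "num_components (with_proj G \<restriction> (pverts G - S))"
  have n: "?n > 1" using assms num_components_gt_1[of "pverts G - S" P p q] by blast
  then have "t * real ?n \<le> real (card S)" using assms(1,3) unfolding tough_def by blast
  moreover have "t * 2 \<le> t * real ?n" using n \<open>t \<ge> 0\<close> by (intro mult_left_mono) auto
  ultimately show ?thesis by simp
qed

section \<open>Deleting an edge at a universal vertex\<close>

lemma pair_graph_delete_edge: "pair_graph (delete_edge G u v)"
proof
  show "symmetric (with_proj (delete_edge G u v))"
    using arcs_symmetric by (auto simp: symmetric_def sym_def delete_edge_def)
qed (use pair_finite_verts pair_finite_arcs pair_no_loops wellformed in
    \<open>auto simp: delete_edge_def\<close>)

text \<open>A set \<open>S\<close> violating toughness after deletion of \<open>vu\<close> leaves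
  exactly two components, one of them \<open>{u}\<close>. Hence \<open>|S| < 2t\<close>, and all
  neighbours of \<open>u\<close> lie in \<open>S\<close> or equal \<open>v\<close>.\<close>

lemma minimally_tough_universal_degree_less:
  assumes "minimally_tough t G" "t > 0" "universal_vertex G v" "u \<in> pverts G" "u \<noteq> v"
  shows "real (card {w. (u, w) \<in> parcs G}) < 2 * t + 1"
proof -
  let ?N = "{w. (u, w) \<in> parcs G}" and ?D = "delete_edge G v u"
  have tough: "tough t G" using assms(1) tough_iff_le_toughness by (simp add: minimally_tough_def)
  interpret D: pair_graph ?D by (rule pair_graph_delete_edge)
  have vu: "(v, u) \<in> parcs G" using assms by (auto simp: universal_vertex_def)
  then have "\<not> tough t ?D"
    using assms(1) D.tough_iff_le_toughness by (auto simp: minimally_tough_def not_le)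
  then obtain S where S: "S \<subseteq> pverts G"
    and n1: "num_components (with_proj ?D \<restriction> (pverts G - S)) > 1"
    and cS: "real (card S) < t * real (num_components (with_proj ?D \<restriction> (pverts G - S)))"
    unfolding tough_def by (auto simp: delete_edge_def not_le)
  let ?H = "with_proj ?D \<restriction> (pverts G - S)"
  interpret H: wf_digraph ?H by (rule D.wellformed_induce_subgraph)
  have adj: "(p, q) \<in> arcs_ends ?H \<longleftrightarrow>
      (p, q) \<in> parcs G \<and> p \<notin> S \<and> q \<notin> S \<and> (p, q) \<noteq> (v, u) \<and> (p, q) \<noteq> (u, v)" for p q
    using in_arcsD1 in_arcsD2
    by (auto simp: delete_edge_def arcs_ends_def arc_to_ends_def image_iff)
  \<comment> \<open>If \<open>S\<close> contained an end of the edge, the deletion would not change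
    \<open>G - S\<close>, and \<open>S\<close> would violate the toughness of
    \<open>G\<close>.\<close>
  have uvS: "u \<notin> S \<and> v \<notin> S"
  proof (rule ccontr)
    assume "\<not> (u \<notin> S \<and> v \<notin> S)"
    then have "?H = with_proj G \<restriction> (pverts G - S)"
      by (auto simp: delete_edge_def induce_subgraph_def with_proj_def)
    then show False using n1 cS S tough by (auto simp: tough_def not_less)
  qed
  have v: "v \<in> pverts G" and univ: "\<And>w. w \<in> pverts G \<Longrightarrow> w \<noteq> v \<Longrightarrow> (v, w) \<in> parcs G"
    using assms(3) by (auto simp: universal_vertex_def)
  have fin: "finite S" using S pair_finite_verts finite_subset by blast
  have "symmetric ?H" unfolding symmetric_def using adj arcs_symmetric by (auto intro!: symI)
  have scc_v: "H.scc_of w = H.scc_of v" if "w \<rightarrow>\<^bsub>?H\<^esub> v" "v \<rightarrow>\<^bsub>?H\<^esub> w" for w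
    using that H.reachable_trans unfolding H.scc_of_def by blast
  \<comment> \<open>Only \<open>u\<close> loses its edge to \<open>v\<close>.\<close>
  have scc_rest: "H.scc_of w = H.scc_of v" if "w \<in> pverts G" "w \<notin> S" "w \<noteq> u" for w
    using that univ[of w] arcs_symmetric[of v w] uvS
    by (cases "w = v") (auto intro!: scc_v simp: adj)
  have sub: "H.sccs_verts \<subseteq> {H.scc_of v, H.scc_of u}"
    unfolding H.sccs_verts_conv_scc_of using scc_rest by auto
  \<comment> \<open>A further neighbour \<open>w\<close> of \<open>u\<close> would link
    \<open>u\<close> to \<open>v\<close>, leaving a single component.\<close>
  have N: "?N \<subseteq> insert v S"
  proof (rule ccontr)
    assume "\<not> ?N \<subseteq> insert v S"
    then obtain w where w: "(u, w) \<in> parcs G" "w \<noteq> v" "w \<notin> S" by blast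
    then have wu: "w \<noteq> u" "w \<in> pverts G" using pair_no_loops in_arcsD2 by force+
    have "H.scc_of w = H.scc_of u"
    proof -
      have "u \<rightarrow>\<^bsub>?H\<^esub> w" "w \<rightarrow>\<^bsub>?H\<^esub> u" using w uvS adj assms(5) wu arcs_symmetric by auto
      then show ?thesis using H.reachable_trans unfolding H.scc_of_def by blast
    qed
    then have "H.sccs_verts \<subseteq> {H.scc_of v}" using sub scc_rest[of w] w wu by auto
    then have "card H.sccs_verts \<le> 1" using card_mono[of "{H.scc_of v}"] by fastforce
    then show False using n1 by (simp add: num_components_def H.card_sccs_verts)
  qed
  have "card H.sccs_verts \<le> card {H.scc_of v, H.scc_of u}" using sub by (intro card_mono) auto
  also have "\<dots> \<le> 2" by (simp add: card_insert_if)
  finally have "num_components ?H \<le> 2" by (simp add: num_components_def H.card_sccs_verts)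
  then have "t * real (num_components ?H) \<le> t * 2" using \<open>t > 0\<close> by (intro mult_left_mono) auto
  moreover have "card ?N \<le> card S + 1"
    using card_mono[OF _ N] fin card_insert_le_m1[of "card S + 1" S v] by auto
  ultimately show ?thesis using cS by linarith
qed

section \<open>The maximal connected set and the contradiction\<close>

text \<open>The bound on \<open>t\<close> says \<open>2t > 1\<close>: a single vertex cannot
  separate the graph.\<close>

lemma chordal_universal_not_minimally_tough:
  assumes "t > 1/2" "minimally_tough t G" "chordal G" "universal_vertex G v"
  shows False
proof -
  have tough: "tough t G"
    using assms(2) tough_iff_le_toughness by (simp add: minimally_tough_def)
  have v: "v \<in> pverts G" and univ: "\<And>w. w \<in> pverts G \<Longrightarrow> w \<noteq> v \<Longrightarrow> (v, w) \<in> parcs G"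
    using assms(4) by (auto simp: universal_vertex_def)
  define conn where "conn A \<longleftrightarrow> (\<forall>a\<in>A. \<forall>a'\<in>A. (a, a') \<in> (parcs G \<inter> A \<times> A)\<^sup>*)" for A
  \<comment> \<open>\<open>far A\<close> is the set \<open>B\<close> of the opening sketch, and
    \<open>F\<close> contains the candidates for \<open>A\<close>.\<close>
  define far where "far A = {b \<in> pverts G - A. \<forall>a\<in>A. (a, b) \<notin> parcs G}" for A
  define F where "F = {A. A \<subseteq> pverts G \<and> A \<noteq> {} \<and> conn A \<and> far A \<noteq> {}}"
  have "finite F" unfolding F_def using pair_finite_verts by simp
  \<comment> \<open>Two non-adjacent vertices would put a singleton into \<open>F\<close>; without
    them the graph is complete and its toughness infinite.\<close>
  moreover have "F \<noteq> {}"
  proof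
    assume "F = {}"
    have "(p, q) \<in> parcs G" if "p \<in> pverts G" "q \<in> pverts G" "p \<noteq> q" for p q
    proof (rule ccontr)
      assume "(p, q) \<notin> parcs G"
      then have "{p} \<in> F" using that by (auto simp: F_def far_def conn_def)
      then show False using \<open>F = {}\<close> by blast
    qed
    then have "parcs G = {(u, v). (u, v) \<in> pverts G \<times> pverts G \<and> u \<noteq> v}"
      using in_arcsD1 in_arcsD2 no_loops' by fast
    then have "toughness G = \<infinity>"
      using pair_finite_verts by (simp add: toughness_def complete_digraph_pair_def)
    then show False using assms(2) by (simp add: minimally_tough_def)
  qed
  ultimately have "Max (card ` F) \<in> card ` F" by simp
  then obtain A where "A \<in> F" "card A = Max (card ` F)" by auto
  then have max: "card A' \<le> card A" if "A' \<in> F" for A' using \<open>finite F\<close> that by simp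
  have A: "A \<subseteq> pverts G" "A \<noteq> {}" "conn A" "far A \<noteq> {}" using \<open>A \<in> F\<close> by (auto simp: F_def)
  then obtain b where b: "b \<in> far A" by blast
  have vA: "v \<notin> A" using b univ by (auto simp: far_def)
  have finA: "finite A" using A(1) pair_finite_verts finite_subset by blast
  \<comment> \<open>Otherwise \<open>insert x A\<close> would be a larger member of
    \<open>F\<close>, with \<open>b'\<close> still far from it.\<close>
  have border: "(x, b') \<in> parcs G"
    if x: "x \<in> pverts G - A" "a \<in> A" "(a, x) \<in> parcs G" and b': "b' \<in> far A" for x a b'
  proof (rule ccontr)
    assume "(x, b') \<notin> parcs G"
    then have far: "far (insert x A) \<noteq> {}" using x b' by (auto simp: far_def)
    define R where "R = parcs G \<inter> insert x A \<times> insert x A"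
    have R: "(p, q) \<in> R\<^sup>*" if "p \<in> A" "q \<in> A" for p q
      using that A(3) rtrancl_mono[of "parcs G \<inter> A \<times> A" R] by (auto simp: conn_def R_def)
    have "(a, x) \<in> R" "(x, a) \<in> R" using x arcs_symmetric by (auto simp: R_def)
    then have "(p, x) \<in> R\<^sup>*" "(x, p) \<in> R\<^sup>*" if "p \<in> A" for p
      using R[OF that x(2)] R[OF x(2) that] by auto
    then have "conn (insert x A)" using R unfolding conn_def R_def[symmetric] by auto
    then have "insert x A \<in> F" using far x A by (simp add: F_def)
    then show False using max[of "insert x A"] x finA by simp
  qed
  \<comment> \<open>Without such an \<open>x\<close>, the set \<open>{v}\<close> would separate
    \<open>A\<close> from \<open>b\<close>, giving \<open>2t \<le> 1\<close>.\<close>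
  obtain x a where x: "x \<in> pverts G - A" "x \<noteq> v" "a \<in> A" "(a, x) \<in> parcs G"
  proof (rule ccontr)
    assume "\<not> thesis"
    then have "\<And>p q. p \<in> A \<Longrightarrow> q \<in> pverts G - {v} - A \<Longrightarrow> (p, q) \<notin> parcs G" using that by blast
    moreover have "b \<noteq> v" using b A univ arcs_symmetric by (fastforce simp: far_def)
    ultimately have "2 * t \<le> real (card {v})"
      using A b v vA assms(1)
      by (intro tough_imp_separator_ge[OF tough, of "{v}" A "SOME a. a \<in> A" b])
        (auto simp: far_def some_in_eq)
    then show False using assms(1) by simp
  qed
  let ?N = "\<lambda>u. {w. (u, w) \<in> parcs G}"
  have finN: "finite (?N u)" for u using in_arcsD2 pair_finite_verts by (auto intro: finite_subset)
  have bx: "(b, x) \<in> parcs G" using border x b arcs_symmetric by blast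
  \<comment> \<open>A neighbour \<open>w\<close> of \<open>b\<close> is either far from
    \<open>A\<close>, where \<open>border\<close> applies, or adjacent to \<open>A\<close>, where
    chordality applies with \<open>b\<close> as common neighbour of \<open>x\<close> and
    \<open>w\<close>.\<close>
  have "(x, w) \<in> parcs G" if w: "(b, w) \<in> parcs G" "w \<noteq> x" for w
  proof (cases "w \<in> far A")
    case True then show ?thesis using border x by blast
  next
    case False
    have wV: "w \<in> pverts G" using w in_arcsD2 by blast
    have "w \<notin> A" using w b arcs_symmetric by (auto simp: far_def)
    then obtain a' where "a' \<in> A" "(a', w) \<in> parcs G" using False wV by (auto simp: far_def)
    moreover have "b \<notin> A" "\<And>a. a \<in> A \<Longrightarrow> (b, a) \<notin> parcs G"
      using b arcs_symmetric by (auto simp: far_def)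
    ultimately show ?thesis
      using chordal_common_neighbours_adjacent[OF assms(3), of A a x a' w b] A(3) x w bx
      by (auto simp: conn_def)
  qed
  \<comment> \<open>Leaving out \<open>x\<close> costs one and adding \<open>a\<close> and
    \<open>b\<close> gains two, hence the surplus of one over the degree of
    \<open>b\<close>.\<close>
  then have "insert a (insert b (?N b - {x})) \<subseteq> ?N x" using x bx arcs_symmetric by auto
  then have "card (insert a (insert b (?N b - {x}))) \<le> card (?N x)" using finN card_mono by blast
  moreover have "a \<noteq> b" "a \<notin> ?N b" "b \<notin> ?N b"
    using b x arcs_symmetric no_loops' by (auto simp: far_def)
  ultimately have "card (?N b) + 1 \<le> card (?N x)"
    using bx finN[of b] card_Suc_Diff1[of "?N b" x] by simp
  \<comment> \<open>The neighbourhood of \<open>b\<close> separates \<open>b\<close> from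
    \<open>a\<close>.\<close>
  moreover have "2 * t \<le> real (card (?N b))"
  proof (rule tough_imp_separator_ge[OF tough, of _ "{b}" b a])
    show "?N b \<subseteq> pverts G" using in_arcsD2 by blast
  qed (use assms(1) b x A \<open>a \<noteq> b\<close> \<open>a \<notin> ?N b\<close> \<open>b \<notin> ?N b\<close> in \<open>auto simp: far_def\<close>)
  moreover have "real (card (?N x)) < 2 * t + 1"
    using minimally_tough_universal_degree_less[OF assms(2) _ assms(4)] x assms(1) by auto
  ultimately show False by linarith
qed

end

theorem theorem4p8:
  fixes t :: real
  assumes "t \<in> \<rat>" and "t > 1"
  shows "\<not> (\<exists>G :: 'a pair_pre_digraph.
            pair_graph G \<and> minimally_tough t G \<and> chordal G \<and> (\<exists>v. universal_vertex G v))"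
  using assms(2) pair_graph.chordal_universal_not_minimally_tough[of _ t] by force

end
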